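(* Suppose $f$ is differentiable and there exists a constant $L>0$ such that $$D_f(y,x)\le L\,D_h(y,x)\quad\text{for all }x,y\in\mathrm{dom}(f),$$ and suppose that, for some $r>1$, the Bregman proximal gradient algorithm described in the context chooses at every iteration $k=0,1,\dots$ a stepsize $t_k$ that is $r$-large (as defined in the context) for the condition $$t_k\mathcal{D}(x_k,y_k,s_{k},\theta_k)/\theta_k \le D_h(s_{k},s_{k-1}),\qquad y_k=s_{k-1}.$$ Then the sequence $x_k$, $k=1,2,\dots$, satisfies $$f(x_k) +\Psi(x_k) -(f(x) + \Psi(x)) \le \frac{rL\,D_h(x, x_0)}{k}$$ for all $x\in E$.
   Context: Setting. $E$ is a real vector space with continuous dual $E^*$ and pairing $\langle\cdot,\cdot\rangle$; $f,\Psi:E\to\mathbb{R}\cup\{\infty\}$ are closed convex with $\mathrm{dom}(\Psi)\subseteq\mathrm{dom}(\partial f)$; $h:E\to\mathbb{R}\cup\{\infty\}$ is a convex differentiable reference function with $\mathrm{dom}(\Psi)\subseteq\overline{\mathrm{dom}(h)}$. $D_h(s,z)=h(s)-h(z)-\langle\nabla h(z),s-z\rangle$ (equal to $+\infty$ if $s\notin\mathrm{dom}(h)$) and $D_f(y,x)=f(y)-f(x)-\langle\nabla f(x),y-x\rangle$. Admissibility. $t>0$ is admissible for $(s_-,g)$ if $\min_s\{t(\langle g,s\rangle+\Psi(s))+D_h(s,s_-)\}$ has a solution $\bar s$ satisfying $t(g+g^\Psi)+\nabla h(\bar s)-\nabla h(s_-)=0$ for some $g^\Psi\in\partial\Psi(\bar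 s)$. Standing assumptions. (a) $f+\Psi$ is bounded below. (b) If $t>0$ and $(s_-,g)$ are such that $s\mapsto t(\langle g,s\rangle+\Psi(s))+D_h(s,s_-)$ is bounded below, then $t$ is admissible for $(s_-,g)$. (c) There is an oracle that, given $(t,s_-,g)$, either determines that $t$ is not admissible for $(s_-,g)$ or returns an optimal solution $\bar s$ of $\min_s\{t(\langle g,s\rangle+\Psi(s))+D_h(s,s_-)\}$ satisfying $t(g+g^\Psi)+\nabla h(\bar s)-\nabla h(s_-)=0$ for some $g^\Psi\in\partial\Psi(\bar s)$. Algorithm. Input $s_{-1}\in\mathrm{dom}(\Psi)\cap\mathrm{dom}(h)$. For $k=0,1,\dots$: let $g_k=\nabla f(s_{k-1})$; pick $t_k>0$ admissible for $(s_{k-1},g_k)$; let $s_k\in\mathrm{argmin}_s\{t_k(\langle g_k,s\rangle+\Psi(s))+D_h(s,s_{k-1})\}$ (the solution returned by the oracle). Set $x_0=s_{-1}$, $x_k=\sum_{i=0}^{k-1}t_is_i/\sum_{i=0}^{k-1}t_i$ for $k\ge1$, $y_k=s_{k-1}$, and $\theta_k=t_k/\sum_{i=0}^kt_i$. The function $\mathcal{D}$. $$\mathcal{D}(x,y,s,\theta)=(f+\Psi)(x+\theta(s-x))-(1-\theta)(f+\Psi)(x)-\theta(f+\Psi)(s)+\theta D_f(s,y).$$ $r$-large. At iteration $k$, for $t>0$ admissible for $(s_{k-1},g_k)$ let $s(t)$ be the solution returned by the oracle and $\theta(t)=t/(t+\sum_{i=0}^{k-1}t_i)$; call $t$ acceptable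 if $t\,\mathcal{D}(x_k,s_{k-1},s(t),\theta(t))/\theta(t)\le D_h(s(t),s_{k-1})$. The stepsize $t_k$ is $r$-large if it is acceptable and within a factor $r$ of the largest acceptable one, i.e. $t_k\ge t/r$ for every acceptable $t$. *)

theory Defs
  imports "HOL-Analysis.Analysis"
begin

class real_tvs = real_vector + topological_ab_group_add +
  assumes tendsto_scaleR_Pair:
    "LIM p (nhds c \<times>\<^sub>F nhds x). fst p *\<^sub>R snd p :> nhds (c *\<^sub>R x)"

instance real_normed_vector \<subseteq> real_tvs
  by standard (auto intro!: tendsto_scaleR filterlim_fst filterlim_snd)

text \<open>A dual vector is the functional itself, so the pairing of \<open>g\<close> and \<open>s\<close> is \<open>g s\<close>.\<close>

definition dual :: "('a::real_tvs \<Rightarrow> real) set" where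
  "dual = {g. linear g \<and> continuous_on UNIV g}"

definition effdom :: "('a \<Rightarrow> ereal) \<Rightarrow> 'a set" where
  "effdom \<phi> = {x. \<phi> x < \<infinity>}"

definition epi :: "('a \<Rightarrow> ereal) \<Rightarrow> ('a \<times> real) set" where
  "epi \<phi> = {(x, a). \<phi> x \<le> ereal a}"

text \<open>Functions into \<open>\<real> \<union> {\<infinity>}\<close> are \<open>ereal\<close>-valued functions that avoid \<open>-\<infinity>\<close>.\<close>

definition convex_fun :: "('a::real_tvs \<Rightarrow> ereal) \<Rightarrow> bool" where
  "convex_fun \<phi> \<longleftrightarrow> (\<forall>x. \<phi> x \<noteq> -\<infinity>) \<and> convex (epi \<phi>)"

definition closed_convex_fun :: "('a::real_tvs \<Rightarrow> ereal) \<Rightarrow> bool" where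
  "closed_convex_fun \<phi> \<longleftrightarrow> convex_fun \<phi> \<and> closed (epi \<phi>)"

definition bounded_below :: "('a \<Rightarrow> ereal) \<Rightarrow> bool" where
  "bounded_below \<phi> \<longleftrightarrow> (\<exists>m::real. \<forall>x. ereal m \<le> \<phi> x)"

definition subdiff :: "('a::real_tvs \<Rightarrow> ereal) \<Rightarrow> 'a \<Rightarrow> ('a \<Rightarrow> real) set" where
  "subdiff \<phi> x =
     {u \<in> dual. x \<in> effdom \<phi> \<and> (\<forall>z. \<phi> x + ereal (u (z - x)) \<le> \<phi> z)}"

text \<open>
  The gradient is the Gateaux one, with values in the continuous dual. The difference quotient is
  taken in \<open>ereal\<close>: since the limit is finite, \<open>\<phi>\<close> must be finite at \<open>x + \<tau> v\<close> for all
  small \<open>\<tau>\<close> of either sign.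
\<close>

definition has_gradient :: "('a::real_tvs \<Rightarrow> ereal) \<Rightarrow> 'a \<Rightarrow> ('a \<Rightarrow> real) \<Rightarrow> bool" where
  "has_gradient \<phi> x g \<longleftrightarrow> g \<in> dual \<and> \<bar>\<phi> x\<bar> \<noteq> \<infinity> \<and>
     (\<forall>v. ((\<lambda>\<tau>::real. (\<phi> (x + \<tau> *\<^sub>R v) - \<phi> x) / ereal \<tau>) \<longlongrightarrow> ereal (g v)) (at 0))"

lemma has_gradient_unique:
  assumes "has_gradient \<phi> x g" "has_gradient \<phi> x g'"
  shows "g = g'"
proof
  fix v
  have "ereal (g v) = ereal (g' v)"
    using assms tendsto_unique[OF trivial_limit_at] unfolding has_gradient_def by blast
  then show "g v = g' v" by simp
qed

definition gradient :: "('a::real_tvs \<Rightarrow> ereal) \<Rightarrow> 'a \<Rightarrow> ('a \<Rightarrow> real)" where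
  "gradient \<phi> x = (THE g. has_gradient \<phi> x g)"

lemma gradient_eqI: "has_gradient \<phi> x g \<Longrightarrow> gradient \<phi> x = g"
  unfolding gradient_def by (blast intro: has_gradient_unique)

lemma has_derivative_imp_has_gradient:
  fixes \<phi> :: "'a::real_normed_vector \<Rightarrow> ereal"
  assumes d: "(F has_derivative g) (at x)"
    and ev: "\<forall>\<^sub>F z in nhds x. \<phi> z = ereal (F z)"
  shows "has_gradient \<phi> x g"
proof -
  interpret bounded_linear g using d by (rule has_derivative_bounded_linear)
  have x: "\<phi> x = ereal (F x)" using ev by (rule eventually_nhds_x_imp_x)
  have lim: "((\<lambda>\<tau>. (\<phi> (x + \<tau> *\<^sub>R v) - \<phi> x) / ereal \<tau>) \<longlongrightarrow> ereal (g v)) (at 0)" for v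
  proof -
    have l: "((\<lambda>\<tau>::real. x + \<tau> *\<^sub>R v) has_derivative (\<lambda>\<tau>. \<tau> *\<^sub>R v)) (at 0)"
      by (auto intro!: derivative_eq_intros)
    have "((\<lambda>\<tau>. F (x + \<tau> *\<^sub>R v)) has_derivative (\<lambda>\<tau>. g (\<tau> *\<^sub>R v))) (at 0)"
      using has_derivative_compose[OF l, of F g] d by simp
    then have "((\<lambda>\<tau>. F (x + \<tau> *\<^sub>R v)) has_field_derivative g v) (at 0)"
      by (simp add: has_field_derivative_def scaleR mult.commute[of "g v"] mult_commute_abs)
    then have q: "((\<lambda>\<tau>. (F (x + \<tau> *\<^sub>R v) - F x) / \<tau>) \<longlongrightarrow> g v) (at 0)"
      by (simp add: DERIV_def)
    have "((\<lambda>\<tau>::real. x + \<tau> *\<^sub>R v) \<longlongrightarrow> x + 0 *\<^sub>R v) (at 0)"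
      by (intro tendsto_intros)
    then have "\<forall>\<^sub>F \<tau> in at 0. \<phi> (x + \<tau> *\<^sub>R v) = ereal (F (x + \<tau> *\<^sub>R v))"
      using ev by (auto simp: filterlim_iff)
    then have "\<forall>\<^sub>F \<tau> in at 0. ereal ((F (x + \<tau> *\<^sub>R v) - F x) / \<tau>)
        = (\<phi> (x + \<tau> *\<^sub>R v) - \<phi> x) / ereal \<tau>"
      using eventually_neq_at_within[of 0 0 UNIV] by eventually_elim (simp add: x)
    with q show ?thesis
      by (blast intro: Lim_transform_eventually tendsto_ereal)
  qed
  show ?thesis
    using lim x linear_axioms linear_continuous_on[OF bounded_linear_axioms]
    by (simp add: has_gradient_def dual_def)
qed

definition differentiable_fun :: "('a::real_tvs \<Rightarrow> ereal) \<Rightarrow> bool" where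
  "differentiable_fun \<phi> \<longleftrightarrow> (\<forall>x \<in> effdom \<phi>. \<exists>g. has_gradient \<phi> x g)"

text \<open>
  The value \<open>\<infinity>\<close> for a base point \<open>x\<close> outside the domain, where there is no gradient, is a
  convention.
\<close>

definition bregman :: "('a::real_tvs \<Rightarrow> ereal) \<Rightarrow> 'a \<Rightarrow> 'a \<Rightarrow> ereal" where
  "bregman \<phi> y x =
     (if y \<in> effdom \<phi> \<and> x \<in> effdom \<phi> then \<phi> y - \<phi> x - ereal (gradient \<phi> x (y - x)) else \<infinity>)"

definition prox_objective ::
    "('a::real_tvs \<Rightarrow> ereal) \<Rightarrow> ('a \<Rightarrow> ereal) \<Rightarrow> real \<Rightarrow> 'a \<Rightarrow> ('a \<Rightarrow> real) \<Rightarrow> 'a \<Rightarrow> ereal" where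
  "prox_objective \<Psi> h t s' g s = ereal t * (ereal (g s) + \<Psi> s) + bregman h s s'"

text \<open>\<open>sb \<in> effdom h\<close> is what makes \<open>gradient h sb\<close> meaningful.\<close>

definition prox_solution ::
    "('a::real_tvs \<Rightarrow> ereal) \<Rightarrow> ('a \<Rightarrow> ereal) \<Rightarrow> real \<Rightarrow> 'a \<Rightarrow> ('a \<Rightarrow> real) \<Rightarrow> 'a \<Rightarrow> bool" where
  "prox_solution \<Psi> h t s' g sb \<longleftrightarrow>
     sb \<in> effdom h \<and>
     (\<forall>s. prox_objective \<Psi> h t s' g sb \<le> prox_objective \<Psi> h t s' g s) \<and>
     (\<exists>g\<Psi> \<in> subdiff \<Psi> sb. \<forall>v. t * (g v + g\<Psi> v) + gradient h sb v - gradient h s' v = 0)"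

definition admissible ::
    "('a::real_tvs \<Rightarrow> ereal) \<Rightarrow> ('a \<Rightarrow> ereal) \<Rightarrow> real \<Rightarrow> 'a \<Rightarrow> ('a \<Rightarrow> real) \<Rightarrow> bool" where
  "admissible \<Psi> h t s' g \<longleftrightarrow> t > 0 \<and> (\<exists>sb. prox_solution \<Psi> h t s' g sb)"

definition prox_oracle ::
    "('a::real_tvs \<Rightarrow> ereal) \<Rightarrow> ('a \<Rightarrow> ereal) \<Rightarrow> (real \<Rightarrow> 'a \<Rightarrow> ('a \<Rightarrow> real) \<Rightarrow> 'a option) \<Rightarrow> bool"
  where
  "prox_oracle \<Psi> h orc \<longleftrightarrow>
     (\<forall>t > 0. \<forall>s' \<in> effdom h. \<forall>g \<in> dual.
        case orc t s' g of
          None \<Rightarrow> \<not> admissible \<Psi> h t s' g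
        | Some sb \<Rightarrow> prox_solution \<Psi> h t s' g sb)"

text \<open>
  The points \<open>s_{-1}, s_0, s_1, \<dots>\<close> are stored with an index shift: \<open>S 0\<close> is \<open>s_{-1}\<close> and
  \<open>S (Suc k)\<close> is \<open>s_k\<close>. In particular \<open>y_k\<close> is \<open>S k\<close> and \<open>g_k\<close> is \<open>gradient f (S k)\<close>.
\<close>

definition bpg ::
    "('a::real_tvs \<Rightarrow> ereal) \<Rightarrow> ('a \<Rightarrow> ereal) \<Rightarrow> ('a \<Rightarrow> ereal) \<Rightarrow>
     (real \<Rightarrow> 'a \<Rightarrow> ('a \<Rightarrow> real) \<Rightarrow> 'a option) \<Rightarrow> (nat \<Rightarrow> real) \<Rightarrow> (nat \<Rightarrow> 'a) \<Rightarrow> bool" where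
  "bpg f \<Psi> h orc t S \<longleftrightarrow>
     S 0 \<in> effdom \<Psi> \<inter> effdom h \<and>
     (\<forall>k. admissible \<Psi> h (t k) (S k) (gradient f (S k)) \<and>
          orc (t k) (S k) (gradient f (S k)) = Some (S (Suc k)))"

definition bpg_x :: "(nat \<Rightarrow> real) \<Rightarrow> (nat \<Rightarrow> 'a::real_tvs) \<Rightarrow> nat \<Rightarrow> 'a" where
  "bpg_x t S k =
     (if k = 0 then S 0
      else (1 / (\<Sum>i<k. t i)) *\<^sub>R (\<Sum>i<k. t i *\<^sub>R S (Suc i)))"

definition calD ::
    "('a::real_tvs \<Rightarrow> ereal) \<Rightarrow> ('a \<Rightarrow> ereal) \<Rightarrow> 'a \<Rightarrow> 'a \<Rightarrow> 'a \<Rightarrow> real \<Rightarrow> ereal" where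
  "calD f \<Psi> x y s \<theta> =
     (f (x + \<theta> *\<^sub>R (s - x)) + \<Psi> (x + \<theta> *\<^sub>R (s - x)))
     - ereal (1 - \<theta>) * (f x + \<Psi> x) - ereal \<theta> * (f s + \<Psi> s) + ereal \<theta> * bregman f s y"

text \<open>Only the values \<open>t i\<close> with \<open>i < k\<close> enter \<open>acceptable\<close>; the candidate is \<open>\<tau>\<close>.\<close>

definition acceptable ::
    "('a::real_tvs \<Rightarrow> ereal) \<Rightarrow> ('a \<Rightarrow> ereal) \<Rightarrow> ('a \<Rightarrow> ereal) \<Rightarrow>
     (real \<Rightarrow> 'a \<Rightarrow> ('a \<Rightarrow> real) \<Rightarrow> 'a option) \<Rightarrow> (nat \<Rightarrow> real) \<Rightarrow> (nat \<Rightarrow> 'a) \<Rightarrow> nat \<Rightarrow> real \<Rightarrow> bool"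
  where
  "acceptable f \<Psi> h orc t S k \<tau> \<longleftrightarrow>
     admissible \<Psi> h \<tau> (S k) (gradient f (S k)) \<and>
     (\<exists>s. orc \<tau> (S k) (gradient f (S k)) = Some s \<and>
        (let \<theta> = \<tau> / (\<tau> + (\<Sum>i<k. t i))
         in ereal \<tau> * calD f \<Psi> (bpg_x t S k) (S k) s \<theta> / ereal \<theta> \<le> bregman h s (S k)))"

definition r_large ::
    "('a::real_tvs \<Rightarrow> ereal) \<Rightarrow> ('a \<Rightarrow> ereal) \<Rightarrow> ('a \<Rightarrow> ereal) \<Rightarrow>
     (real \<Rightarrow> 'a \<Rightarrow> ('a \<Rightarrow> real) \<Rightarrow> 'a option) \<Rightarrow> (nat \<Rightarrow> real) \<Rightarrow> (nat \<Rightarrow> 'a) \<Rightarrow> nat \<Rightarrow> real \<Rightarrow> bool"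
  where
  "r_large f \<Psi> h orc t S k r \<longleftrightarrow>
     acceptable f \<Psi> h orc t S k (t k) \<and>
     (\<forall>\<tau>. acceptable f \<Psi> h orc t S k \<tau> \<longrightarrow> t k \<ge> \<tau> / r)"

end

theory Submission
  imports Defs
begin

text \<open>
  Write \<open>F = f + \<Psi>\<close> and \<open>T k\<close> for the sum of the first \<open>k\<close> stepsizes,
  and \<open>D_f\<close>, \<open>D_h\<close> for the Bregman distances. The theorem combines an
  ergodic estimate, which holds for arbitrary acceptable stepsizes, with a lower bound on the
  stepsizes, which comes from relative smoothness.

  For the estimate, the optimality condition of the proximal step and the three-point identity for
  \<open>bregman h\<close> give (\<open>prox_step\<close>), for \<open>z = S k\<close> and \<open>s = S (Suc k)\<close>,
  \<open>t k * (F(s) - D_f(s, z) - F(x)) \<le> D_h(x, z) - D_h(x, s) - D_h(s, z)\<close>.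
  The quantity \<open>calD\<close> is the amount by which \<open>F\<close> at the new average exceeds the convex
  combination of \<open>F\<close> at the old average and \<open>F(s) - D_f(s, z)\<close>. Acceptability says precisely
  that this excess, multiplied by \<open>T (Suc k)\<close>, is paid for by the term \<open>- D_h(s, z)\<close>. What
  remains telescopes (\<open>accepted_step\<close>), and therefore \<open>T k * (F (x_k) - F x) \<le> D_h(x, x_0)\<close>
  (\<open>ergodic_bound\<close>).

  For the stepsizes, convexity of \<open>F\<close> gives \<open>calD \<le> \<theta> * D_f(s, z)\<close> (\<open>calD_le\<close>), and relative
  smoothness gives \<open>D_f(s, z) \<le> L * D_h(s, z)\<close>, so \<open>1 / L\<close> passes the acceptability test
  (\<open>acceptable_inverse_smoothness\<close>). It is also admissible, because relative smoothness bounds the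
  proximal objective from below by a positive multiple of \<open>F\<close> plus a constant
  (\<open>bounded_below_prox_objective\<close>). An \<open>r\<close>-large stepsize is then at least \<open>1 / (r * L)\<close>, hence
  \<open>T k \<ge> k / (r * L)\<close>.
\<close>

section \<open>Convex functions with values in the extended reals\<close>

lemma convex_fun_finite:
  assumes "convex_fun \<phi>" "x \<in> effdom \<phi>"
  shows "\<phi> x = ereal (real_of_ereal (\<phi> x))"
  using assms by (cases "\<phi> x") (auto simp: convex_fun_def effdom_def)

lemma convex_fun_segment:
  assumes \<phi>: "convex_fun \<phi>" and x: "x \<in> effdom \<phi>" and y: "y \<in> effdom \<phi>"
    and \<theta>: "0 \<le> \<theta>" "\<theta> \<le> 1"
  shows "\<phi> (x + \<theta> *\<^sub>R (y - x))
    \<le> ereal ((1 - \<theta>) * real_of_ereal (\<phi> x) + \<theta> * real_of_ereal (\<phi> y))"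
proof -
  have epi: "(x, real_of_ereal (\<phi> x)) \<in> epi \<phi>" "(y, real_of_ereal (\<phi> y)) \<in> epi \<phi>"
    using convex_fun_finite[OF \<phi> x] convex_fun_finite[OF \<phi> y] by (auto simp: epi_def)
  have "convex (epi \<phi>)"
    using \<phi> by (simp add: convex_fun_def)
  from convexD_alt[OF this epi \<theta>] show ?thesis
    by (simp add: epi_def algebra_simps)
qed

lemma effdom_segment:
  assumes "convex_fun \<phi>" "x \<in> effdom \<phi>" "y \<in> effdom \<phi>" "0 \<le> \<theta>" "\<theta> \<le> 1"
  shows "x + \<theta> *\<^sub>R (y - x) \<in> effdom \<phi>"
  using convex_fun_segment[OF assms] by (auto simp: effdom_def)

lemma gradient_dual:
  assumes "differentiable_fun \<phi>" "x \<in> effdom \<phi>"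
  shows "gradient \<phi> x \<in> dual"
proof -
  obtain g where "has_gradient \<phi> x g"
    using assms by (auto simp: differentiable_fun_def)
  then show ?thesis
    by (simp add: gradient_eqI) (simp add: has_gradient_def)
qed

lemma gradient_diff:
  assumes "differentiable_fun \<phi>" "x \<in> effdom \<phi>"
  shows "gradient \<phi> x (u - v) = gradient \<phi> x u - gradient \<phi> x v"
  using gradient_dual[OF assms] by (simp add: dual_def linear_diff)

text \<open>
  Convexity bounds the difference quotient of \<open>\<phi>\<close> at \<open>x\<close> in the direction \<open>y - x\<close> by
  \<open>\<phi> y - \<phi> x\<close> for every step length in \<open>(0, 1)\<close>, and the gradient is its one-sided limit.
\<close>

lemma gradient_inequality:
  assumes \<phi>: "convex_fun \<phi>" "differentiable_fun \<phi>" and x: "x \<in> effdom \<phi>" and y: "y \<in> effdom \<phi>"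
  shows "gradient \<phi> x (y - x) \<le> real_of_ereal (\<phi> y) - real_of_ereal (\<phi> x)"
proof -
  let ?q = "\<lambda>\<tau>::real. (\<phi> (x + \<tau> *\<^sub>R (y - x)) - \<phi> x) / ereal \<tau>"
  have "has_gradient \<phi> x (gradient \<phi> x)"
    using \<phi>(2) x by (auto simp: differentiable_fun_def gradient_eqI)
  then have "(?q \<longlongrightarrow> ereal (gradient \<phi> x (y - x))) (at 0)"
    by (simp add: has_gradient_def)
  then have lim: "(?q \<longlongrightarrow> ereal (gradient \<phi> x (y - x))) (at_right 0)"
    by (rule filterlim_mono) (auto intro: at_le)
  have q: "?q \<tau> \<le> ereal (real_of_ereal (\<phi> y) - real_of_ereal (\<phi> x))" if \<tau>: "0 < \<tau>" "\<tau> < 1" for \<tau>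
  proof -
    obtain a where a: "\<phi> x = ereal a"
      using convex_fun_finite[OF \<phi>(1) x] by blast
    obtain b where b: "\<phi> y = ereal b"
      using convex_fun_finite[OF \<phi>(1) y] by blast
    obtain c where c: "\<phi> (x + \<tau> *\<^sub>R (y - x)) = ereal c"
      using convex_fun_finite[OF \<phi>(1) effdom_segment[OF \<phi>(1) x y]] \<tau> by (metis less_imp_le)
    have "c \<le> (1 - \<tau>) * a + \<tau> * b"
      using convex_fun_segment[OF \<phi>(1) x y, of \<tau>] \<tau> by (simp add: a b c)
    then have "(c - a) / \<tau> \<le> b - a"
      using \<tau> by (simp add: divide_simps algebra_simps)
    then show ?thesis
      using \<tau> by (simp add: a b c)
  qed
  have "\<forall>\<^sub>F \<tau> in at_right (0::real). ?q \<tau> \<le> ereal (real_of_ereal (\<phi> y) - real_of_ereal (\<phi> x))"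
    unfolding eventually_at_right_field using q by (intro exI[of _ 1]) auto
  from tendsto_upperbound[OF lim this] show ?thesis
    by simp
qed

lemma bregman_finite:
  assumes "convex_fun \<phi>" "x \<in> effdom \<phi>" "y \<in> effdom \<phi>"
  shows "bregman \<phi> y x
    = ereal (real_of_ereal (\<phi> y) - real_of_ereal (\<phi> x) - gradient \<phi> x (y - x))"
proof -
  obtain a b where "\<phi> x = ereal a" "\<phi> y = ereal b"
    using convex_fun_finite[OF assms(1,2)] convex_fun_finite[OF assms(1,3)] by blast
  then show ?thesis
    using assms(2,3) by (simp add: bregman_def)
qed

lemma bregman_nonneg:
  assumes "convex_fun \<phi>" "differentiable_fun \<phi>"
  shows "0 \<le> bregman \<phi> y x"
proof (cases "x \<in> effdom \<phi> \<and> y \<in> effdom \<phi>")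
  case True
  then show ?thesis
    using gradient_inequality[OF assms, of x y] by (simp add: bregman_finite[OF assms(1)])
qed (auto simp: bregman_def)

text \<open>
  By convexity of \<open>f + \<Psi>\<close> the first three terms of \<open>calD\<close> have a nonpositive sum, so the only
  positive contribution comes from linearizing \<open>f\<close>.
\<close>

lemma calD_le:
  assumes f: "convex_fun f" and \<Psi>: "convex_fun \<Psi>"
    and x: "x \<in> effdom f" "x \<in> effdom \<Psi>" and s: "s \<in> effdom f" "s \<in> effdom \<Psi>"
    and y: "y \<in> effdom f" and \<theta>: "0 \<le> \<theta>" "\<theta> \<le> 1"
  shows "calD f \<Psi> x y s \<theta> \<le> ereal \<theta> * bregman f s y"
proof -
  let ?z = "x + \<theta> *\<^sub>R (s - x)"
  obtain a b c where f_val: "f x = ereal a" "f s = ereal b" "f ?z = ereal c"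
    using convex_fun_finite[OF f] effdom_segment[OF f x(1) s(1) \<theta>] x s by metis
  obtain a' b' c' where \<Psi>_val: "\<Psi> x = ereal a'" "\<Psi> s = ereal b'" "\<Psi> ?z = ereal c'"
    using convex_fun_finite[OF \<Psi>] effdom_segment[OF \<Psi> x(2) s(2) \<theta>] x s by metis
  obtain d where d: "bregman f s y = ereal d"
    using bregman_finite[OF f y s(1)] by blast
  have "c \<le> (1 - \<theta>) * a + \<theta> * b" "c' \<le> (1 - \<theta>) * a' + \<theta> * b'"
    using convex_fun_segment[OF f x(1) s(1) \<theta>] convex_fun_segment[OF \<Psi> x(2) s(2) \<theta>]
    by (simp_all add: f_val \<Psi>_val)
  then have "c + c' - (1 - \<theta>) * (a + a') - \<theta> * (b + b') + \<theta> * d \<le> \<theta> * d"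
    by (simp add: algebra_simps)
  then show ?thesis
    by (simp add: calD_def f_val \<Psi>_val d)
qed

section \<open>The proximal step\<close>

lemma prox_solution_effdom:
  assumes "prox_solution \<Psi> h t z g s"
  shows "s \<in> effdom \<Psi>" "s \<in> effdom h"
  using assms by (auto simp: prox_solution_def subdiff_def)

text \<open>
  The optimality condition of the step turns \<open>t\<close> times the slope of the model of \<open>f + \<Psi>\<close> in the
  direction \<open>x - s\<close> into the pairing of \<open>gradient h z - gradient h s\<close> with \<open>x - s\<close>, which the
  three-point identity expresses by Bregman distances. Both \<open>f\<close> and \<open>\<Psi>\<close> lie above their linear
  models; the model of \<open>f\<close> is based at \<open>z\<close>, so comparing with \<open>f s\<close> costs the distance
  \<open>bregman f s z\<close>.
\<close>

lemma prox_step: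
  assumes f: "convex_fun f" "differentiable_fun f" and \<Psi>: "convex_fun \<Psi>"
    and h: "convex_fun h" "differentiable_fun h" and dom: "effdom \<Psi> \<subseteq> effdom f"
    and prox: "prox_solution \<Psi> h t z (gradient f z) s" and t: "t > 0"
    and z: "z \<in> effdom f" "z \<in> effdom h" and x: "x \<in> effdom \<Psi>" "x \<in> effdom h"
  shows "t * (real_of_ereal (f s) + real_of_ereal (\<Psi> s) - real_of_ereal (bregman f s z)
        - (real_of_ereal (f x) + real_of_ereal (\<Psi> x)))
    \<le> real_of_ereal (bregman h x z) - real_of_ereal (bregman h x s) - real_of_ereal (bregman h s z)"
proof -
  have s: "s \<in> effdom \<Psi>" "s \<in> effdom h"
    using prox_solution_effdom[OF prox] by auto
  obtain p where p: "p \<in> subdiff \<Psi> s"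
    and opt: "\<And>v. t * (gradient f z v + p v) + gradient h s v - gradient h z v = 0"
    using prox unfolding prox_solution_def by blast
  obtain a b where ab: "\<Psi> s = ereal a" "\<Psi> x = ereal b"
    using convex_fun_finite[OF \<Psi>] s(1) x(1) by metis
  have "\<Psi> s + ereal (p (x - s)) \<le> \<Psi> x"
    using p by (simp add: subdiff_def)
  then have p_ineq: "a + p (x - s) \<le> b"
    by (simp add: ab)
  have f_ineq: "gradient f z (x - z) \<le> real_of_ereal (f x) - real_of_ereal (f z)"
    using gradient_inequality[OF f z(1)] x(1) dom by blast
  have f_diff: "gradient f z (x - z) = gradient f z (x - s) + gradient f z (s - z)"
    using gradient_diff[OF f(2) z(1)] by simp
  have h_diff: "gradient h z (x - z) = gradient h z (x - s) + gradient h z (s - z)"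
    using gradient_diff[OF h(2) z(2)] by simp
  \<comment> \<open>The term \<open>gradient f z (s - z)\<close> is absorbed by \<open>bregman f s z\<close>, which leaves a slope along \<open>x - s\<close>.\<close>
  have "t * (real_of_ereal (f s) + a - real_of_ereal (bregman f s z) - (real_of_ereal (f x) + b))
      \<le> t * (- (gradient f z (x - s) + p (x - s)))"
    using t p_ineq f_ineq f_diff bregman_finite[OF f(1) z(1), of s] s(1) dom
    by (intro mult_left_mono) auto
  also have "\<dots> = gradient h s (x - s) - gradient h z (x - s)"
    using opt[of "x - s"] by (simp add: algebra_simps)
  also have "\<dots> = real_of_ereal (bregman h x z) - real_of_ereal (bregman h x s)
      - real_of_ereal (bregman h s z)"
    using h_diff by (simp add: bregman_finite[OF h(1)] z s x)
  finally show ?thesis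
    by (simp add: ab)
qed

section \<open>Runs of the Bregman proximal gradient algorithm\<close>

locale bpg_run =
  fixes f \<Psi> h :: "'a::real_tvs \<Rightarrow> ereal"
    and orc :: "real \<Rightarrow> 'a \<Rightarrow> ('a \<Rightarrow> real) \<Rightarrow> 'a option"
    and t :: "nat \<Rightarrow> real" and S :: "nat \<Rightarrow> 'a"
  assumes f: "convex_fun f" "differentiable_fun f"
    and \<Psi>: "convex_fun \<Psi>"
    and h: "convex_fun h" "differentiable_fun h"
    and dom: "effdom \<Psi> \<subseteq> effdom f"
    and oracle_spec: "prox_oracle \<Psi> h orc"
    and run: "bpg f \<Psi> h orc t S"
begin

lemma stepsize_pos: "t k > 0"
  using run by (simp add: bpg_def admissible_def)

lemma oracle_solution:
  assumes "\<tau> > 0" "z \<in> effdom \<Psi>" "z \<in> effdom h" "orc \<tau> z (gradient f z) = Some s"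
  shows "prox_solution \<Psi> h \<tau> z (gradient f z) s"
proof -
  have "gradient f z \<in> dual"
    using gradient_dual[OF f(2)] assms(2) dom by blast
  with oracle_spec assms(1,3,4) show ?thesis
    unfolding prox_oracle_def by fastforce
qed

lemma iterate_effdom: "S k \<in> effdom \<Psi> \<and> S k \<in> effdom h"
proof (induction k)
  case 0
  then show ?case
    using run by (simp add: bpg_def)
next
  case (Suc k)
  have "orc (t k) (S k) (gradient f (S k)) = Some (S (Suc k))"
    using run by (simp add: bpg_def)
  then show ?case
    using oracle_solution[OF stepsize_pos] Suc prox_solution_effdom by blast
qed

lemma step_solution: "prox_solution \<Psi> h (t k) (S k) (gradient f (S k)) (S (Suc k))"
  using oracle_solution[OF stepsize_pos] iterate_effdom run by (simp add: bpg_def)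

lemma stepsize_sum_nonneg: "0 \<le> (\<Sum>i<k. t i)"
  by (simp add: sum_nonneg less_imp_le stepsize_pos)

text \<open>
  For \<open>k = 0\<close> the weight of the new point is \<open>1\<close>, so the initial value \<open>S 0\<close> drops out.
\<close>

lemma bpg_x_Suc:
  "bpg_x t S (Suc k)
    = bpg_x t S k + (t k / (t k + (\<Sum>i<k. t i))) *\<^sub>R (S (Suc k) - bpg_x t S k)"
proof (cases "k = 0")
  case True
  then show ?thesis
    using stepsize_pos[of 0] by (simp add: bpg_x_def)
next
  case False
  define T where "T = (\<Sum>i<k. t i)"
  define U where "U = (\<Sum>i<k. t i *\<^sub>R S (Suc i))"
  have T: "T > 0"
    unfolding T_def using False stepsize_pos by (intro sum_pos) auto
  have "1 - t k / (t k + T) = T / (t k + T)"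
    using T stepsize_pos[of k] by (simp add: field_simps)
  then have c: "(1 - t k / (t k + T)) / T = 1 / (t k + T)"
    using T by simp
  have "bpg_x t S k + (t k / (t k + T)) *\<^sub>R (S (Suc k) - bpg_x t S k)
      = (1 - t k / (t k + T)) *\<^sub>R bpg_x t S k + (t k / (t k + T)) *\<^sub>R S (Suc k)"
    by (simp add: algebra_simps)
  also have "(1 - t k / (t k + T)) *\<^sub>R bpg_x t S k = (1 / (t k + T)) *\<^sub>R U"
    using False c by (simp add: bpg_x_def T_def U_def)
  also have "(1 / (t k + T)) *\<^sub>R U + (t k / (t k + T)) *\<^sub>R S (Suc k) = bpg_x t S (Suc k)"
    by (simp add: bpg_x_def T_def U_def add.commute scaleR_add_right)
  finally show ?thesis
    by (simp add: T_def)
qed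

lemma bpg_x_effdom: "bpg_x t S k \<in> effdom \<Psi>"
proof (induction k)
  case 0
  then show ?case
    using iterate_effdom by (simp add: bpg_x_def)
next
  case (Suc k)
  then show ?case
    unfolding bpg_x_Suc using stepsize_pos[of k] stepsize_sum_nonneg[of k] iterate_effdom
    by (intro effdom_segment[OF \<Psi>]) auto
qed

abbreviation F :: "'a \<Rightarrow> real" where
  "F x \<equiv> real_of_ereal (f x) + real_of_ereal (\<Psi> x)"

lemma F_eq:
  assumes "x \<in> effdom \<Psi>"
  shows "f x + \<Psi> x = ereal (F x)"
proof -
  have "f x = ereal (real_of_ereal (f x))" "\<Psi> x = ereal (real_of_ereal (\<Psi> x))"
    using convex_fun_finite[OF f(1)] convex_fun_finite[OF \<Psi>] assms dom by blast+
  then show ?thesis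
    by (cases "f x"; cases "\<Psi> x") auto
qed

text \<open>
  Multiplied by the total stepsize, the definition of \<open>calD\<close> expresses \<open>F\<close> at the new average
  by its values at the old average and at the new iterate. Acceptability bounds the term in
  \<open>calD\<close> by \<open>bregman h (S (Suc k)) (S k)\<close>, which is exactly the term that the proximal step gains.
\<close>

lemma accepted_step:
  assumes acc: "acceptable f \<Psi> h orc t S k (t k)" and x: "x \<in> effdom \<Psi>" "x \<in> effdom h"
  shows "(\<Sum>i<Suc k. t i) * (F (bpg_x t S (Suc k)) - F x)
    \<le> (\<Sum>i<k. t i) * (F (bpg_x t S k) - F x)
      + real_of_ereal (bregman h x (S k)) - real_of_ereal (bregman h x (S (Suc k)))"
proof -
  define T where "T = (\<Sum>i<k. t i)"
  define \<theta> where "\<theta> = t k / (t k + T)"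
  let ?s = "S (Suc k)"
  have pos: "t k > 0" "T \<ge> 0"
    using stepsize_pos stepsize_sum_nonneg by (auto simp: T_def)
  then have \<theta>: "\<theta> > 0" and \<theta>T: "\<theta> * (t k + T) = t k" "t k / \<theta> = t k + T"
    by (auto simp: \<theta>_def)
  have dom_s: "?s \<in> effdom \<Psi>" "?s \<in> effdom f" "?s \<in> effdom h"
    and dom_z: "S k \<in> effdom f" "S k \<in> effdom h"
    using iterate_effdom dom by auto
  have new: "bpg_x t S (Suc k) = bpg_x t S k + \<theta> *\<^sub>R (?s - bpg_x t S k)"
    unfolding \<theta>_def T_def by (rule bpg_x_Suc)
  have Df: "bregman f ?s (S k) = ereal (real_of_ereal (bregman f ?s (S k)))"
    and Dh: "bregman h ?s (S k) = ereal (real_of_ereal (bregman h ?s (S k)))"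
    using dom_s dom_z by (simp_all add: bregman_finite f(1) h(1))
  define d where "d = F (bpg_x t S (Suc k)) - (1 - \<theta>) * F (bpg_x t S k) - \<theta> * F ?s
    + \<theta> * real_of_ereal (bregman f ?s (S k))"
  have calD: "calD f \<Psi> (bpg_x t S k) (S k) ?s \<theta> = ereal d"
    unfolding calD_def new[symmetric] d_def
    by (subst Df) (simp add: F_eq bpg_x_effdom dom_s)
  have "orc (t k) (S k) (gradient f (S k)) = Some ?s"
    using run by (simp add: bpg_def)
  then have "ereal (t k) * calD f \<Psi> (bpg_x t S k) (S k) ?s \<theta> / ereal \<theta> \<le> bregman h ?s (S k)"
    using acc by (simp add: acceptable_def Let_def \<theta>_def T_def)
  then have "t k * d / \<theta> \<le> real_of_ereal (bregman h ?s (S k))"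
    unfolding calD using \<theta> by (subst (asm) Dh) simp
  then have d: "(t k + T) * d \<le> real_of_ereal (bregman h ?s (S k))"
    using \<theta>T(2) by (metis times_divide_eq_left)
  have "(t k + T) * d = (t k + T) * F (bpg_x t S (Suc k)) - T * F (bpg_x t S k)
      - t k * (F ?s - real_of_ereal (bregman f ?s (S k)))"
  proof -
    have "(t k + T) * d = (t k + T) * F (bpg_x t S (Suc k))
        - ((t k + T) - \<theta> * (t k + T)) * F (bpg_x t S k)
        - \<theta> * (t k + T) * (F ?s - real_of_ereal (bregman f ?s (S k)))"
      by (simp add: d_def algebra_simps)
    then show ?thesis
      unfolding \<theta>T(1) by simp
  qed
  moreover have "t k * (F ?s - real_of_ereal (bregman f ?s (S k)) - F x)
      \<le> real_of_ereal (bregman h x (S k)) - real_of_ereal (bregman h x ?s)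
        - real_of_ereal (bregman h ?s (S k))"
    by (rule prox_step[OF f \<Psi> h dom step_solution stepsize_pos dom_z x])
  moreover have "(\<Sum>i<Suc k. t i) = t k + T"
    by (simp add: T_def)
  ultimately show ?thesis
    using d by (simp add: T_def[symmetric] algebra_simps)
qed

lemma ergodic_bound:
  assumes acc: "\<And>k. acceptable f \<Psi> h orc t S k (t k)" and x: "x \<in> effdom \<Psi>" "x \<in> effdom h"
  shows "(\<Sum>i<k. t i) * (F (bpg_x t S k) - F x) \<le> real_of_ereal (bregman h x (S 0))"
proof -
  have "(\<Sum>i<k. t i) * (F (bpg_x t S k) - F x)
      \<le> real_of_ereal (bregman h x (S 0)) - real_of_ereal (bregman h x (S k))"
  proof (induction k)
    case (Suc k)
    then show ?case
      using accepted_step[OF acc x, of k] by linarith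
  qed simp
  moreover have "0 \<le> real_of_ereal (bregman h x (S k))"
    by (rule real_of_ereal_pos[OF bregman_nonneg[OF h]])
  ultimately show ?thesis
    by linarith
qed

text \<open>
  By relative smoothness, \<open>bregman h s z\<close> is at least \<open>1 / L\<close> times \<open>bregman f s z\<close>. With
  \<open>\<tau> = 1 / L\<close> the linear terms cancel, and the objective of the step is at least
  \<open>1 / L\<close> times \<open>f s + \<Psi> s\<close>, up to a constant.
\<close>

lemma bounded_below_prox_objective:
  assumes L: "L > 0"
    and smooth: "\<And>x y. x \<in> effdom f \<Longrightarrow> y \<in> effdom f \<Longrightarrow> bregman f y x \<le> ereal L * bregman h y x"
    and bdd: "bounded_below (\<lambda>x. f x + \<Psi> x)" and z: "z \<in> effdom \<Psi>" "z \<in> effdom h"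
  shows "bounded_below (prox_objective \<Psi> h (1 / L) z (gradient f z))"
proof -
  obtain m where m: "\<And>x. ereal m \<le> f x + \<Psi> x"
    using bdd by (auto simp: bounded_below_def)
  have zf: "z \<in> effdom f"
    using z dom by blast
  have "ereal ((m - real_of_ereal (f z) + gradient f z z) / L)
      \<le> prox_objective \<Psi> h (1 / L) z (gradient f z) s" for s
  proof (cases "s \<in> effdom \<Psi> \<and> s \<in> effdom h")
    case True
    then have sf: "s \<in> effdom f"
      using dom by blast
    obtain d where d: "bregman h s z = ereal d"
      using bregman_finite[OF h(1) z(2)] True by blast
    obtain p where p: "\<Psi> s = ereal p"
      using convex_fun_finite[OF \<Psi>] True by blast
    have "m \<le> real_of_ereal (f s) + p"
      using m[of s] F_eq[of s] True by (simp add: p)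
    moreover have "real_of_ereal (f s) - real_of_ereal (f z) - gradient f z (s - z) \<le> L * d"
      using smooth[OF zf sf] by (simp add: d bregman_finite[OF f(1) zf sf])
    ultimately have "m - real_of_ereal (f z) + gradient f z z \<le> gradient f z s + p + L * d"
      by (simp add: gradient_diff[OF f(2) zf])
    then have "(m - real_of_ereal (f z) + gradient f z z) / L \<le> (gradient f z s + p + L * d) / L"
      using L by (simp add: divide_right_mono)
    then show ?thesis
      using L by (simp add: prox_objective_def p d add_divide_distrib)
  next
    case False
    have "\<Psi> s \<noteq> -\<infinity>"
      using \<Psi> by (simp add: convex_fun_def)
    moreover have "0 \<le> bregman h s z"
      by (rule bregman_nonneg[OF h])
    moreover have "\<Psi> s = \<infinity> \<or> bregman h s z = \<infinity>"
      using False by (auto simp: effdom_def bregman_def)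
    ultimately have "prox_objective \<Psi> h (1 / L) z (gradient f z) s = \<infinity>"
      unfolding prox_objective_def using L
      by (cases "\<Psi> s"; cases "bregman h s z") auto
    then show ?thesis
      by simp
  qed
  then show ?thesis
    unfolding bounded_below_def by blast
qed

text \<open>
  The test asks for \<open>\<tau> * calD / \<theta> \<le> bregman h s z\<close>. Since \<open>calD / \<theta>\<close> is at most
  \<open>bregman f s z\<close>, which is at most \<open>L * bregman h s z\<close>, it is passed at \<open>\<tau> = 1 / L\<close>
  whatever the current average is.
\<close>

lemma acceptable_inverse_smoothness:
  assumes L: "L > 0"
    and smooth: "\<And>x y. x \<in> effdom f \<Longrightarrow> y \<in> effdom f \<Longrightarrow> bregman f y x \<le> ereal L * bregman h y x"
    and adm: "admissible \<Psi> h (1 / L) (S k) (gradient f (S k))"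
  shows "acceptable f \<Psi> h orc t S k (1 / L)"
proof -
  define \<theta> where "\<theta> = 1 / L / (1 / L + (\<Sum>i<k. t i))"
  have "1 / L > 0"
    using L by simp
  then have "0 < 1 / L + (\<Sum>i<k. t i)"
    using stepsize_sum_nonneg[of k] by linarith
  then have \<theta>: "0 < \<theta>" "\<theta> \<le> 1"
    unfolding \<theta>_def using \<open>1 / L > 0\<close> stepsize_sum_nonneg[of k]
    by (simp_all only: zero_less_divide_iff pos_divide_le_eq) simp_all
  have z: "S k \<in> effdom \<Psi>" "S k \<in> effdom h" "S k \<in> effdom f"
    using iterate_effdom dom by auto
  have "gradient f (S k) \<in> dual"
    using gradient_dual[OF f(2) z(3)] .
  then obtain s where s: "orc (1 / L) (S k) (gradient f (S k)) = Some s"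
    using oracle_spec adm z \<open>1 / L > 0\<close> unfolding prox_oracle_def
    by (metis option.exhaust option.simps(4))
  have dom_s: "s \<in> effdom \<Psi>" "s \<in> effdom h" "s \<in> effdom f"
    using prox_solution_effdom[OF oracle_solution[OF \<open>1 / L > 0\<close> z(1,2) s]] dom by auto
  obtain d e where d: "bregman f s (S k) = ereal d" and e: "bregman h s (S k) = ereal e"
    using bregman_finite[OF f(1) z(3) dom_s(3)] bregman_finite[OF h(1) z(2) dom_s(2)] by blast
  have "d \<le> L * e"
    using smooth[OF z(3) dom_s(3)] by (simp add: d e)
  then have de: "d / L \<le> e"
    using L by (simp add: field_simps)
  have "calD f \<Psi> (bpg_x t S k) (S k) s \<theta> \<le> ereal (\<theta> * d)"
    using calD_le[OF f(1) \<Psi>, of "bpg_x t S k" s "S k" \<theta>] bpg_x_effdom dom dom_s z \<theta>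
    by (auto simp: d)
  then have "ereal (1 / L) * calD f \<Psi> (bpg_x t S k) (S k) s \<theta> / ereal \<theta>
      \<le> ereal (1 / L) * ereal (\<theta> * d) / ereal \<theta>"
    using L \<theta> by (intro ereal_divide_right_mono ereal_mult_left_mono) auto
  also have "\<dots> \<le> bregman h s (S k)"
    using de L \<theta> by (simp add: e)
  finally show ?thesis
    using adm s by (simp add: acceptable_def Let_def \<theta>_def)
qed

end

section \<open>The convergence rate\<close>

theorem proposition3:
  fixes f \<Psi> h :: "'a::real_tvs \<Rightarrow> ereal"
    and orc :: "real \<Rightarrow> 'a \<Rightarrow> ('a \<Rightarrow> real) \<Rightarrow> 'a option"
    and t :: "nat \<Rightarrow> real" and S :: "nat \<Rightarrow> 'a" and L r :: real
  assumes "closed_convex_fun f" and "closed_convex_fun \<Psi>"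
    and "effdom \<Psi> \<subseteq> {x. subdiff f x \<noteq> {}}"
    and "convex_fun h" and "differentiable_fun h"
    and "effdom \<Psi> \<subseteq> closure (effdom h)"
    and "bounded_below (\<lambda>x. f x + \<Psi> x)"
    and "\<And>\<tau> s' g. \<tau> > 0 \<Longrightarrow> s' \<in> effdom h \<Longrightarrow> g \<in> dual \<Longrightarrow>
           bounded_below (prox_objective \<Psi> h \<tau> s' g) \<Longrightarrow> admissible \<Psi> h \<tau> s' g"
    and "prox_oracle \<Psi> h orc"
    and "differentiable_fun f"
    and "L > 0"
    and "\<And>x y. x \<in> effdom f \<Longrightarrow> y \<in> effdom f \<Longrightarrow> bregman f y x \<le> ereal L * bregman h y x"
    and "r > 1"
    and "bpg f \<Psi> h orc t S"
    and "\<And>k. r_large f \<Psi> h orc t S k r"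
  shows "\<forall>k\<ge>1. \<forall>x. f (bpg_x t S k) + \<Psi> (bpg_x t S k) - (f x + \<Psi> x)
           \<le> ereal (r * L) * bregman h x (bpg_x t S 0) / ereal (real k)"
proof (intro allI impI)
  fix k :: nat and x :: 'a
  assume k: "1 \<le> k"
  have "effdom \<Psi> \<subseteq> effdom f"
    using assms(3) by (auto simp: subdiff_def)
  then interpret bpg_run f \<Psi> h orc t S
    using assms(1,2,4,5,9,10,14) by unfold_locales (auto simp: closed_convex_fun_def)
  let ?T = "\<Sum>i<k. t i"
  have acc: "acceptable f \<Psi> h orc t S j (t j)" for j
    using assms(15) by (simp add: r_large_def)
  have step: "1 / (r * L) \<le> t j" for j
  proof -
    have z: "S j \<in> effdom \<Psi>" "S j \<in> effdom h"
      using iterate_effdom by auto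
    then have "gradient f (S j) \<in> dual"
      using gradient_dual[OF f(2)] dom by blast
    moreover have "bounded_below (prox_objective \<Psi> h (1 / L) (S j) (gradient f (S j)))"
      by (rule bounded_below_prox_objective[OF assms(11,12,7) z])
    ultimately have "admissible \<Psi> h (1 / L) (S j) (gradient f (S j))"
      using assms(8,11) z by simp
    then have "acceptable f \<Psi> h orc t S j (1 / L)"
      using acceptable_inverse_smoothness[OF assms(11,12)] by blast
    then have "1 / L / r \<le> t j"
      using assms(15)[of j] unfolding r_large_def by blast
    then show ?thesis
      by (simp add: mult.commute)
  qed
  have rL: "r * L > 0"
    using assms(11,13) by simp
  have "real k / (r * L) \<le> ?T"
    using sum_mono[of "{..<k}" "\<lambda>_. 1 / (r * L)" t] step by simp
  then have T: "real k \<le> r * L * ?T"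
    using rL by (simp add: pos_divide_le_eq mult.commute)
  then have T_pos: "?T > 0"
    using k rL by (smt (verit) mult_nonneg_nonpos of_nat_1 of_nat_mono)
  show "f (bpg_x t S k) + \<Psi> (bpg_x t S k) - (f x + \<Psi> x)
      \<le> ereal (r * L) * bregman h x (bpg_x t S 0) / ereal (real k)"
  proof (cases "x \<in> effdom \<Psi> \<and> x \<in> effdom h")
    case True
    define D where "D = real_of_ereal (bregman h x (S 0))"
    have D: "bregman h x (S 0) = ereal D"
      using True iterate_effdom by (simp add: D_def bregman_finite[OF h(1)])
    have "0 \<le> D"
      unfolding D_def by (rule real_of_ereal_pos[OF bregman_nonneg[OF h]])
    have "?T * (F (bpg_x t S k) - F x) \<le> D"
      unfolding D_def using ergodic_bound[OF acc] True by blast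
    then have "F (bpg_x t S k) - F x \<le> D / ?T"
      using T_pos by (simp add: pos_le_divide_eq mult.commute)
    also have "\<dots> \<le> r * L * D / real k"
      using mult_right_mono[OF T \<open>0 \<le> D\<close>] T_pos k by (simp add: field_simps)
    finally show ?thesis
      using k True by (simp add: F_eq bpg_x_effdom bpg_x_def[of t S 0] D)
  next
    case False
    \<comment> \<open>Either the left-hand side is \<open>-\<infinity>\<close> or the right-hand side is \<open>\<infinity>\<close>.\<close>
    show ?thesis
    proof (cases "x \<in> effdom h")
      case True
      with False have "\<Psi> x = \<infinity>"
        by (simp add: effdom_def)
      moreover have "f x \<noteq> -\<infinity>"
        using f(1) by (simp add: convex_fun_def)
      ultimately show ?thesis
        by (simp add: F_eq bpg_x_effdom)
    next
      case False
      then have "bregman h x (bpg_x t S 0) = \<infinity>"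
        by (simp add: bregman_def)
      then show ?thesis
        using k assms(11,13) by simp
    qed
  qed
qed

end
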